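(* Let $L'(x,y)=(-x+2y+1,y)$ and $L''(x,y)=(x,2x-y+1)$ on $\mathbb{Z}^2$, let $\mathscr{P}_L(0,0)$ be the set of points obtained from $(0,0)$ by applying finitely many (possibly zero) of these operators in any order, and let $\mathscr{R}_L(0,0)=\{m : m\in\{x,y\},\ (x,y)\in\mathscr{P}_L(0,0)\}$ be the set of represented integers. For $T>0$, an integer $p\ge2$ and $0\le l<p$, let $N_L(l,p;T)=\#\{r\in\mathscr{R}_L(0,0): r\le T,\ r\equiv l\pmod p\}$ and $$\delta_L(l,p)=\lim_{T\to\infty}\frac{N_L(l,p;T)}{\#\big(\mathscr{R}_L(0,0)\cap[0,T]\big)}.$$ Let $p$ be a prime. Then: (1) if $p=2$, then $\delta_L(0,2)=\delta_L(1,2)=\frac12$; (2) if $p\ge3$, then for $0\le l<p$: $\delta_L(l,p)=0$ if $\left(\frac{2l+2^{-2}}{p}\right)=-1$; $\delta_L(l,p)=\frac1p$ if $l\equiv-2^{-3}\pmod p$; and $\delta_L(l,p)=\frac2p$ if $\left(\frac{2l+2^{-2}}{p}\right)=1$. Here $\left(\frac{\cdot}{p}\right)$ is the Legendre symbol and the inverses $2^{-2},2^{-3}$ are taken modulo $p$. *)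

theory Defs
  imports Complex_Main "HOL-Number_Theory.Number_Theory"
begin

definition L1 :: "int \<times> int \<Rightarrow> int \<times> int" where
  "L1 = (\<lambda>(x, y). (- x + 2 * y + 1, y))"

definition L2 :: "int \<times> int \<Rightarrow> int \<times> int" where
  "L2 = (\<lambda>(x, y). (x, 2 * x - y + 1))"

inductive_set orbit :: "int \<times> int \<Rightarrow> (int \<times> int) set" for z :: "int \<times> int" where
  base: "z \<in> orbit z"
| step1: "w \<in> orbit z \<Longrightarrow> L1 w \<in> orbit z"
| step2: "w \<in> orbit z \<Longrightarrow> L2 w \<in> orbit z"

definition represented :: "int \<times> int \<Rightarrow> int set" where
  "represented z = {m. \<exists>x y. (x, y) \<in> orbit z \<and> m \<in> {x, y}}"

(* All integers represented from (0, 0) are nonnegative, so for z = (0, 0) the sets counted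
   below are finite. *)

definition count_class :: "int \<times> int \<Rightarrow> int \<Rightarrow> int \<Rightarrow> real \<Rightarrow> nat" where
  "count_class z l p T = card {r \<in> represented z. real_of_int r \<le> T \<and> [r = l] (mod p)}"

definition count_all :: "int \<times> int \<Rightarrow> real \<Rightarrow> nat" where
  "count_all z T = card {r \<in> represented z. 0 \<le> r \<and> real_of_int r \<le> T}"

(* The density of the class l mod p exists and equals d. *)
definition has_density :: "int \<times> int \<Rightarrow> int \<Rightarrow> int \<Rightarrow> real \<Rightarrow> bool" where
  "has_density z l p d \<longleftrightarrow>
     ((\<lambda>T. real (count_class z l p T) / real (count_all z T)) \<longlongrightarrow> d) at_top"

end

theory Submission
  imports Defs "HOL-Library.Nat_Bijection"
begin

text \<open>
  The orbit of \<open>(0, 0)\<close> consists of \<open>(0, 0)\<close> and the pairs of consecutive triangular numbers, so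
  exactly the triangular numbers are represented. Since they increase with their index \<open>n\<close>, and
  their class modulo \<open>p\<close> is periodic in \<open>n\<close>, each density is the proportion of indices in one
  period that hit the class. For odd \<open>p\<close> and \<open>i = 1/2\<close> modulo \<open>p\<close>, completing the square turns
  \<open>n (n + 1) / 2 \<equiv> l\<close> into \<open>(n + i)\<^sup>2 \<equiv> 2 l + i\<^sup>2\<close>.
\<close>

section \<open>The represented integers\<close>

text \<open>Each operator fixes one coordinate and reflects the other. If the fixed one is the
  triangular number t_n, then the old and new values of the other sum to 2 t_n + 1 = t_(n-1) +
  t_(n+1), so the reflection swaps the two neighbours of t_n.\<close>

lemma orbit_zero_cases:
  assumes "w \<in> orbit (0, 0)"
  shows "w = (0, 0) \<or> (\<exists>n. w = (int (triangle n), int (triangle (Suc n))) \<or>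
           w = (int (triangle (Suc n)), int (triangle n)))"
  using assms
proof induction
  case base
  then show ?case by simp
next
  case (step1 w)
  then consider "w = (0, 0)"
    | n where "w = (int (triangle n), int (triangle (Suc n)))"
    | n where "w = (int (triangle (Suc n)), int (triangle n))"
    by blast
  then show ?case
  proof cases
    case 1
    then show ?thesis by (auto simp: L1_def intro!: exI[of _ 0])
  next
    case (2 n)
    then show ?thesis by (auto simp: L1_def intro!: exI[of _ "Suc n"])
  next
    case (3 n)
    \<comment> \<open>The larger coordinate drops to the triangular number before
      \<open>triangle n\<close>; at \<open>n = 0\<close> there is none, and the pair falls back to
      \<open>(0, 0)\<close>.\<close>
    then show ?thesis by (cases n) (auto simp: L1_def)
  qed
next
  case (step2 w)
  then consider "w = (0, 0)"
    | n where "w = (int (triangle n), int (triangle (Suc n)))"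
    | n where "w = (int (triangle (Suc n)), int (triangle n))"
    by blast
  then show ?case
  proof cases
    case 1
    then show ?thesis by (auto simp: L2_def intro!: exI[of _ 0])
  next
    case (2 n)
    then show ?thesis by (cases n) (auto simp: L2_def)
  next
    case (3 n)
    then show ?thesis by (auto simp: L2_def intro!: exI[of _ "Suc n"])
  qed
qed

text \<open>Reflecting the smaller coordinate produces the next triangular number and reverses the
  order of the pair. Either order suffices, because \<open>represented\<close> only looks at the
  coordinates.\<close>

lemma triangle_pair_in_orbit:
  "(int (triangle n), int (triangle (Suc n))) \<in> orbit (0, 0) \<or>
   (int (triangle (Suc n)), int (triangle n)) \<in> orbit (0, 0)"
proof (induction n)
  case 0
  show ?case using orbit.step1[OF orbit.base, of "(0, 0)"] by (simp add: L1_def)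
next
  case (Suc n)
  then show ?case
  proof
    assume "(int (triangle n), int (triangle (Suc n))) \<in> orbit (0, 0)"
    from orbit.step1[OF this] show ?thesis by (simp add: L1_def algebra_simps)
  next
    assume "(int (triangle (Suc n)), int (triangle n)) \<in> orbit (0, 0)"
    from orbit.step2[OF this] show ?thesis by (simp add: L2_def algebra_simps)
  qed
qed

lemma represented_zero: "represented (0, 0) = range (\<lambda>n. int (triangle n))"
proof
  show "represented (0, 0) \<subseteq> range (\<lambda>n. int (triangle n))"
  proof
    fix m assume "m \<in> represented (0, 0)"
    then obtain x y where "(x, y) \<in> orbit (0, 0)" "m = x \<or> m = y"
      by (auto simp: represented_def)
    moreover have "0 = int (triangle 0)" by simp
    ultimately show "m \<in> range (\<lambda>n. int (triangle n))"
      using orbit_zero_cases[of "(x, y)"] by blast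
  qed
  show "range (\<lambda>n. int (triangle n)) \<subseteq> represented (0, 0)"
    using triangle_pair_in_orbit by (fastforce simp: represented_def simp del: triangle_Suc)
qed

section \<open>Densities of periodic sets of indices\<close>

lemma strict_mono_triangle: "strict_mono triangle"
  by (simp add: strict_mono_Suc_iff)

lemma periodic_mod:
  fixes P :: "nat \<Rightarrow> bool"
  assumes "\<And>n. P (n + q) \<longleftrightarrow> P n"
  shows "P (k * q + n) \<longleftrightarrow> P n"
proof (induction k)
  case (Suc k)
  have "P (Suc k * q + n) \<longleftrightarrow> P ((k * q + n) + q)" by (simp add: algebra_simps)
  with Suc assms show ?case by simp
qed simp

lemma card_periodic:
  fixes P :: "nat \<Rightarrow> bool"
  assumes per: "\<And>n. P (n + q) \<longleftrightarrow> P n"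
  shows "card {n. n < k * q + r \<and> P n} = k * card {n. n < q \<and> P n} + card {n. n < r \<and> P n}"
proof -
  \<comment> \<open>Any period \<open>a\<close> is allowed here: \<open>a = q\<close> peels off
    single periods in the induction, and \<open>a = k * q\<close> separates the remainder at the
    end.\<close>
  have shift: "card {n. n < a + b \<and> P n} = card {n. n < a \<and> P n} + card {n. n < b \<and> P n}"
    if "\<And>n. P (a + n) \<longleftrightarrow> P n" for a b
  proof -
    have "{n. n < a + b \<and> P n} = {n. n < a \<and> P n} \<union> (+) a ` {n. n < b \<and> P n}"
    proof (intro equalityI subsetI)
      fix n assume n: "n \<in> {n. n < a + b \<and> P n}"
      show "n \<in> {n. n < a \<and> P n} \<union> (+) a ` {n. n < b \<and> P n}"
      proof (cases "n < a")
        case False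
        then have "n = a + (n - a)" by simp
        moreover from this n that[of "n - a"] False have "n - a < b" "P (n - a)" by auto
        ultimately show ?thesis by blast
      qed (use n in auto)
    qed (use that in auto)
    moreover have "card ({n. n < a \<and> P n} \<union> (+) a ` {n. n < b \<and> P n})
        = card {n. n < a \<and> P n} + card ((+) a ` {n. n < b \<and> P n})"
      by (rule card_Un_disjoint) auto
    ultimately show ?thesis by (simp add: card_image)
  qed
  have "card {n. n < k * q \<and> P n} = k * card {n. n < q \<and> P n}"
  proof (induction k)
    case (Suc k)
    have "P (q + n) \<longleftrightarrow> P n" for n using per[of n] by (simp add: add.commute)
    from shift[OF this, of "k * q"] Suc show ?case by simp
  qed simp
  with shift[of "k * q" r] periodic_mod[of P, OF per] show ?thesis by simp
qed

text \<open>With \<open>N = k * q + r\<close>, the deviation from the limit is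
  \<open>(s * q - r * c) / (N * q)\<close>, where \<open>c\<close> and \<open>s\<close> count the
  hits in a full period and in the remainder. Both products lie between 0 and \<open>q * q\<close>,
  so the deviation is at most \<open>q / N\<close>.\<close>

lemma density_periodic:
  fixes P :: "nat \<Rightarrow> bool"
  assumes per: "\<And>n. P (n + q) \<longleftrightarrow> P n" and q: "q > 0"
  shows "(\<lambda>N. real (card {n. n < N \<and> P n}) / real N) \<longlonglongrightarrow> real (card {n. n < q \<and> P n}) / real q"
    (is "_ \<longlonglongrightarrow> real ?c / _")
proof -
  have bound: "norm (real (card {n. n < N \<and> P n}) / real N - real ?c / real q) \<le> real q / real N"
    if N: "N > 0" for N
  proof -
    define k r where "k = N div q" and "r = N mod q"
    define s where "s = card {n. n < r \<and> P n}"
    have N_eq: "N = k * q + r" by (simp add: k_def r_def)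
    have rq: "r < q" using q by (simp add: r_def)
    have "s \<le> card {..<r}" unfolding s_def by (intro card_mono) auto
    then have sr: "s \<le> r" by simp
    have "?c \<le> card {..<q}" by (intro card_mono) auto
    then have cq: "?c \<le> q" by simp
    have card_N: "card {n. n < N \<and> P n} = k * ?c + s"
      unfolding N_eq s_def using per by (rule card_periodic)
    have "real s * real q \<le> real q * real q" "real r * real ?c \<le> real q * real q"
      using sr rq cq by (intro mult_mono; simp)+
    then have "\<bar>real s * real q - real r * real ?c\<bar> \<le> real q * real q"
      by (smt (verit) mult_nonneg_nonneg of_nat_0_le_iff)
    moreover have "real (card {n. n < N \<and> P n}) / real N - real ?c / real q
        = (real s * real q - real r * real ?c) / (real N * real q)"
    proof -
      have "real (card {n. n < N \<and> P n}) * real q - real ?c * real N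
          = real s * real q - real r * real ?c"
        unfolding card_N by (simp add: N_eq algebra_simps)
      then show ?thesis using N q by (simp add: diff_frac_eq)
    qed
    ultimately show ?thesis using N q by (simp add: divide_simps abs_mult)
  qed
  have "(\<lambda>N. real q / real N) \<longlonglongrightarrow> 0" by (rule lim_const_over_n)
  then have "(\<lambda>N. real (card {n. n < N \<and> P n}) / real N - real ?c / real q) \<longlonglongrightarrow> 0"
    by (rule tendsto_0_le[where K = 1])
       (use bound in \<open>auto intro!: eventually_sequentiallyI[of 1]\<close>)
  then show ?thesis by (rule LIM_zero_cancel)
qed

text \<open>This passes from values bounded by a real \<open>T\<close> to indices below
  \<open>M T\<close>. Injectivity turns both counts into counts of indices, and since
  \<open>M\<close> tends to infinity the limit along \<open>N\<close> can be composed with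
  it.\<close>

lemma has_density_triangle:
  assumes per: "\<And>n. [int (triangle (n + q)) = int (triangle n)] (mod p)" and q: "q > 0"
  shows "has_density (0, 0) l p
           (real (card {n. n < q \<and> [int (triangle n) = l] (mod p)}) / real q)"
proof -
  define M where "M T = card {n. real (triangle n) \<le> T}" for T
  have le_triangle: "n \<le> triangle n" for n by (induction n) auto
  have M_eq: "{n. real (triangle n) \<le> T} = {..<M T}" for T
  proof -
    define A where "A = {n. real (triangle n) \<le> T}"
    have "A \<subseteq> {..nat \<lceil>T\<rceil>}"
    proof
      fix n assume "n \<in> A"
      then have "real n \<le> T" using le_triangle[of n] by (simp add: A_def)
      then show "n \<in> {..nat \<lceil>T\<rceil>}" by (simp, linarith)
    qed
    then have fin: "finite A" by (rule finite_subset) simp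
    have down: "m \<in> A" if "n \<in> A" "m \<le> n" for m n
    proof -
      have "triangle m \<le> triangle n"
        using that(2) strict_mono_triangle by (simp add: strict_mono_less_eq)
      with that(1) show ?thesis by (simp add: A_def)
    qed
    \<comment> \<open>A finite, downward closed set of naturals is the initial segment ending at its
      first gap.\<close>
    define N where "N = (LEAST n. n \<notin> A)"
    have "\<exists>n. n \<notin> A" using fin infinite_UNIV_nat by (metis ex_new_if_finite)
    then have "N \<notin> A" unfolding N_def by (metis LeastI)
    moreover have "n \<in> A" if "n < N" for n using that not_less_Least unfolding N_def by blast
    ultimately have "A = {..<N}" using down by (metis equalityI lessThan_iff not_le subsetI)
    then show ?thesis using card_lessThan[of N] by (simp add: M_def A_def)
  qed
  have iff: "real (triangle n) \<le> T \<longleftrightarrow> n < M T" for n T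
    using M_eq[of T] by blast
  have inj: "inj (\<lambda>n. int (triangle n))"
    using strict_mono_eq[OF strict_mono_triangle] by (simp add: inj_def)
  have all: "count_all (0, 0) T = M T" for T
  proof -
    have "{r \<in> represented (0, 0). 0 \<le> r \<and> real_of_int r \<le> T}
        = (\<lambda>n. int (triangle n)) ` {n. real (triangle n) \<le> T}"
      by (auto simp: represented_zero)
    then show ?thesis
      unfolding count_all_def M_def using inj by (simp add: card_image inj_on_subset)
  qed
  have cls: "count_class (0, 0) l p T = card {n. n < M T \<and> [int (triangle n) = l] (mod p)}" for T
  proof -
    have "{r \<in> represented (0, 0). real_of_int r \<le> T \<and> [r = l] (mod p)}
        = (\<lambda>n. int (triangle n)) ` {n. n < M T \<and> [int (triangle n) = l] (mod p)}"
      by (auto simp: represented_zero iff)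
    then show ?thesis
      unfolding count_class_def using inj by (simp add: card_image inj_on_subset)
  qed
  have "filterlim M at_top at_top"
    unfolding filterlim_at_top
  proof
    fix K
    show "\<forall>\<^sub>F T in at_top. K \<le> M T"
      using eventually_ge_at_top[of "real (triangle K)"]
    proof eventually_elim
      case (elim T)
      then show ?case by (simp add: iff less_imp_le)
    qed
  qed
  moreover have "[int (triangle (n + q)) = l] (mod p) \<longleftrightarrow> [int (triangle n) = l] (mod p)" for n
    using per[of n] by (metis cong_sym cong_trans)
  ultimately show ?thesis
    unfolding has_density_def all cls
    by (intro filterlim_compose[OF density_periodic]) (use q in auto)
qed

section \<open>Counting solutions modulo a prime\<close>

lemma two_triangle: "2 * int (triangle n) = int n * (int n + 1)"
  by (induction n) (simp_all add: algebra_simps)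

text \<open>The doubled value is a polynomial in the index, hence periodic modulo \<open>p\<close>,
  and 2 can be cancelled as \<open>p\<close> is odd.\<close>

lemma triangle_periodic_odd:
  assumes "odd p"
  shows "[int (triangle (n + p)) = int (triangle n)] (mod int p)"
proof -
  have "[2 * int (triangle (n + p)) = 2 * int (triangle n)] (mod int p)"
    unfolding two_triangle by (intro cong_mult cong_add) (auto simp: cong_def)
  moreover have "coprime 2 (int p)" using assms by simp
  ultimately show ?thesis by (metis cong_mult_lcancel)
qed

lemma triangle_cong_iff:
  fixes p i l :: int
  assumes "odd p" and i: "[2 * i = 1] (mod p)"
  shows "[int (triangle n) = l] (mod p) \<longleftrightarrow> [(int n + i)\<^sup>2 = 2 * l + i\<^sup>2] (mod p)"
proof -
  have "[int (triangle n) = l] (mod p) \<longleftrightarrow> [2 * int (triangle n) = 2 * l] (mod p)"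
    using assms by (simp add: cong_mult_lcancel)
  also have "\<dots> \<longleftrightarrow> [2 * int (triangle n) + i\<^sup>2 = 2 * l + i\<^sup>2] (mod p)"
    by (simp add: cong_add_rcancel)
  also have "[(int n + i)\<^sup>2 = 2 * int (triangle n) + i\<^sup>2] (mod p)"
  proof -
    \<comment> \<open>Replacing \<open>2 * i\<close> by 1 turns the product into
      \<open>n * (n + 1)\<close>, the doubled triangular number.\<close>
    have "(int n + i)\<^sup>2 = int n * (int n + 2 * i) + i\<^sup>2"
      by (simp add: power2_eq_square algebra_simps)
    then show ?thesis
      unfolding two_triangle using i by (auto intro!: cong_add cong_mult)
  qed
  then have "[2 * int (triangle n) + i\<^sup>2 = 2 * l + i\<^sup>2] (mod p) \<longleftrightarrow>
      [(int n + i)\<^sup>2 = 2 * l + i\<^sup>2] (mod p)"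
    by (metis cong_sym cong_trans)
  finally show ?thesis .
qed

lemma card_shifted_square_cong:
  fixes p i y :: int
  assumes p: "prime p" "odd p"
  shows "card {n. n < nat p \<and> [(int n + i)\<^sup>2 = y\<^sup>2] (mod p)} = (if [y = 0] (mod p) then 1 else 2)"
proof -
  have p0: "p > 0" using p(1) prime_gt_0_int by blast
  have root: "n < nat p \<and> [int n + i = z] (mod p) \<longleftrightarrow> n = nat ((z - i) mod p)" for n z
  proof -
    have "[int n + i = z] (mod p) \<longleftrightarrow> [int n = z - i] (mod p)"
      by (simp add: cong_iff_dvd_diff algebra_simps)
    moreover have "n < nat p \<Longrightarrow> int n mod p = int n" by simp
    moreover have "0 \<le> (z - i) mod p" "(z - i) mod p < p" using p0 by auto
    ultimately show ?thesis by (auto simp: cong_def)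
  qed
  have "[(int n + i)\<^sup>2 = y\<^sup>2] (mod p) \<longleftrightarrow>
      [int n + i = y] (mod p) \<or> [int n + i = - y] (mod p)" for n
  proof -
    have "(int n + i)\<^sup>2 - y\<^sup>2 = (int n + i - y) * (int n + i - - y)"
      by (simp add: power2_eq_square algebra_simps)
    then show ?thesis by (simp only: cong_iff_dvd_diff prime_dvd_mult_iff[OF p(1)])
  qed
  then have "{n. n < nat p \<and> [(int n + i)\<^sup>2 = y\<^sup>2] (mod p)}
      = {nat ((y - i) mod p), nat ((- y - i) mod p)}"
    using root by blast
  moreover have "nat ((y - i) mod p) = nat ((- y - i) mod p) \<longleftrightarrow> [y = 0] (mod p)"
  proof -
    have "nat ((y - i) mod p) = nat ((- y - i) mod p) \<longleftrightarrow> [y - i = - y - i] (mod p)"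
      using p0 by (simp add: cong_def nat_eq_iff)
    also have "\<dots> \<longleftrightarrow> p dvd 2 * y" by (simp add: cong_iff_dvd_diff)
    also have "\<dots> \<longleftrightarrow> p dvd y" using p by (simp add: coprime_dvd_mult_right_iff)
    finally show ?thesis by (simp add: cong_0_iff)
  qed
  ultimately show ?thesis by (simp add: card_insert_if)
qed

theorem theorem1p3:
  fixes p :: int
  assumes "prime p"
  shows "(p = 2 \<longrightarrow> has_density (0, 0) 0 2 (1 / 2) \<and> has_density (0, 0) 1 2 (1 / 2)) \<and>
    (p \<ge> 3 \<longrightarrow> (\<forall>l::int. 0 \<le> l \<and> l < p \<longrightarrow>
        (Legendre (2 * l + modular_inverse p 2 ^ 2) p = - 1 \<longrightarrow> has_density (0, 0) l p 0) \<and>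
        ([l = - (modular_inverse p 2 ^ 3)] (mod p) \<longrightarrow> has_density (0, 0) l p (1 / real_of_int p)) \<and>
        (Legendre (2 * l + modular_inverse p 2 ^ 2) p = 1 \<longrightarrow>
           has_density (0, 0) l p (2 / real_of_int p))))"
proof (intro conjI impI allI)
  \<comment> \<open>Halving costs a factor 2 in the period when \<open>p = 2\<close>: the parities
    of 0, 1, 3, 6 form one period, with two even and two odd values.\<close>
  have per: "[int (triangle (n + 4)) = int (triangle n)] (mod 2)" for n
  proof -
    have "2 * int (triangle (n + 4)) = 2 * (int (triangle n) + 2 * (2 * int n + 5))"
      unfolding distrib_left two_triangle by (simp add: algebra_simps)
    then have "int (triangle (n + 4)) = int (triangle n) + 2 * (2 * int n + 5)" by simp
    then show ?thesis unfolding cong_iff_dvd_diff by simp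
  qed
  have vals: "triangle 1 = 1" "triangle (Suc 0) = 1" "triangle 2 = 3" "triangle 3 = 6"
    by (simp_all add: eval_nat_numeral)
  have less4: "n < 4 \<longleftrightarrow> n = 0 \<or> n = 1 \<or> n = 2 \<or> n = 3" for n :: nat by auto
  have "{n. n < 4 \<and> [int (triangle n) = 0] (mod 2)} = {0, 3}"
    by (auto simp: less4 cong_def vals)
  with has_density_triangle[of 4 2 0, OF per]
  show "has_density (0, 0) 0 2 (1 / 2)" by simp
  have "{n. n < 4 \<and> [int (triangle n) = 1] (mod 2)} = {1, 2}"
    by (auto simp: less4 cong_def vals)
  with has_density_triangle[of 4 2 1, OF per]
  show "has_density (0, 0) 1 2 (1 / 2)" by simp
next
  fix l assume p3: "p \<ge> 3"
  define i where "i = modular_inverse p 2"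
  define a where "a = 2 * l + i\<^sup>2"
  have odd: "odd p" using assms p3 prime_odd_int by simp
  then have i: "[2 * i = 1] (mod p)"
    unfolding i_def by (intro cong_modular_inverse1) (simp add: coprime_commute)
  have density: "has_density (0, 0) l p
      (real (card {n. n < nat p \<and> [(int n + i)\<^sup>2 = a] (mod p)}) / real_of_int p)"
    using has_density_triangle[of "nat p" p l] triangle_periodic_odd[of "nat p"] odd p3
    by (simp add: triangle_cong_iff[OF odd i] a_def even_nat_iff)
  \<comment> \<open>Both nonzero densities follow from a square root \<open>y\<close> of
    \<open>a\<close>: the double root 0 gives one solution, a nonzero root gives two.\<close>
  have square: "has_density (0, 0) l p ((if [y = 0] (mod p) then 1 else 2) / real_of_int p)"
    if "[y\<^sup>2 = a] (mod p)" for y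
  proof -
    have "[(int n + i)\<^sup>2 = a] (mod p) \<longleftrightarrow> [(int n + i)\<^sup>2 = y\<^sup>2] (mod p)" for n
      using that by (metis cong_sym cong_trans)
    with density card_shifted_square_cong[OF assms odd, of i y] show ?thesis
      by (simp split: if_splits)
  qed
  show "has_density (0, 0) l p 0" if "Legendre (2 * l + modular_inverse p 2 ^ 2) p = - 1"
  proof -
    from that have "\<not> QuadRes p a"
      by (auto simp: Legendre_def a_def i_def split: if_splits)
    then have "{n. n < nat p \<and> [(int n + i)\<^sup>2 = a] (mod p)} = {}"
      by (auto simp: QuadRes_def)
    with density show ?thesis by simp
  qed
  show "has_density (0, 0) l p (1 / real_of_int p)"
    if "[l = - (modular_inverse p 2 ^ 3)] (mod p)"
  proof -
    \<comment> \<open>Since \<open>2 * i\<close> is 1 modulo \<open>p\<close>, this reduces to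
      \<open>- (i\<^sup>2)\<close>, so the residue \<open>l\<close> is the one where
      \<open>a\<close> vanishes.\<close>
    have "[2 * l = 2 * - (i ^ 3)] (mod p)"
      using that by (intro cong_mult) (auto simp: i_def)
    also have "2 * - (i ^ 3) = (2 * i) * - (i\<^sup>2)" by (simp add: eval_nat_numeral)
    also have "[(2 * i) * - (i\<^sup>2) = 1 * - (i\<^sup>2)] (mod p)" by (intro cong_mult i cong_refl)
    finally have "[a = 0] (mod p)" by (simp add: a_def cong_iff_dvd_diff)
    then have "[0\<^sup>2 = a] (mod p)" by (simp add: cong_sym_eq)
    from square[OF this] show ?thesis by simp
  qed
  show "has_density (0, 0) l p (2 / real_of_int p)"
    if "Legendre (2 * l + modular_inverse p 2 ^ 2) p = 1"
  proof -
    \<comment> \<open>The value 1 also rules out \<open>a\<close> divisible by \<open>p\<close>,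
      where the symbol is 0; hence the root \<open>y\<close> is nonzero.\<close>
    from that have "QuadRes p a" "\<not> [a = 0] (mod p)"
      by (auto simp: Legendre_def a_def i_def split: if_splits)
    then obtain y where y: "[y\<^sup>2 = a] (mod p)" by (auto simp: QuadRes_def)
    have "\<not> [y = 0] (mod p)"
    proof
      assume "[y = 0] (mod p)"
      then have "[y\<^sup>2 = 0] (mod p)" by (simp add: cong_0_iff power2_eq_square)
      with y \<open>\<not> [a = 0] (mod p)\<close> show False by (metis cong_sym cong_trans)
    qed
    with square[OF y] show ?thesis by simp
  qed
qed

end
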